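(* Let $n,d\ge 1$, let $D=\{t_1,\dots,t_n\}$ be a dataset of $n$ tuples in $\mathbb{R}^d$, let $\lambda_1,\dots,\lambda_d\ge 0$ be reals, and let $D'=\{t'_1,\dots,t'_n\}$ be the shifted dataset with $t'_i[j]=\lambda_j+t_i[j]$ for all $i\in\{1,\dots,n\}$ and $j\in\{1,\dots,d\}$. Then for every integer $r\ge 1$, every nonempty set $\mathbb{U}\subseteq\mathbb{L}$ of utility vectors, and every nonempty index set $I\subseteq\{1,\dots,n\}$ with $|I|\le r$: the set $\{t_i: i\in I\}$ is an optimal solution of the RRRM problem for $(D,\mathbb{U},r)$ if and only if $\{t'_i: i\in I\}$ is an optimal solution of the RRRM problem for $(D',\mathbb{U},r)$. In particular (taking $\mathbb{U}=\mathbb{L}$) the same holds for the RRM problem. That is, RRM and RRRM are shift invariant.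
   Context: A dataset $D$ is a finite set of $n$ distinct tuples with $d$ real attributes; $t[i]$ is the $i$-th attribute of $t$. $\mathbb{L}=\{u\in\mathbb{R}^d: u[i]\ge 0\ \forall i\}$ is the set of (linear) utility vectors. The utility of $t$ for $u$ is $w(u,t)=\sum_{i=1}^d u[i]t[i]$. The rank $\nabla_u(t)$ of $t\in D$ for $u$ is one plus the number of tuples $t'\in D$ with $w(u,t')>w(u,t)$. For nonempty $S\subseteq D$, the rank-regret of $S$ for $u$ is $\nabla_u(S)=\min_{t\in S}\nabla_u(t)$, and for a nonempty set $\mathbb{U}$ of utility vectors, $\nabla_{\mathbb{U}}(S)=\max_{u\in\mathbb{U}}\nabla_u(S)$. (Ranks are always computed within the dataset under consideration, $D$ or $D'$.) RRRM problem: given $D$, $\mathbb{U}\subseteq\mathbb{L}$ and an integer $r\ge1$, find a set minimizing $\nabla_{\mathbb{U}}(S)$ among nonempty $S\subseteq D$ with $|S|\le r$; such a minimizer is an optimal solution. RRM problem: the case $\mathbb{U}=\mathbb{L}$. *)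

theory Defs
  imports "HOL-Analysis.Analysis"
begin

definition linear_utilities :: "(real ^ 'd) set"
  where "linear_utilities = {u. \<forall>i. 0 \<le> u $ i}"

definition utility :: "real ^ 'd \<Rightarrow> real ^ 'd \<Rightarrow> real"
  where "utility u t = (\<Sum>i\<in>UNIV. u $ i * t $ i)"

definition tuple_rank :: "(real ^ 'd) set \<Rightarrow> real ^ 'd \<Rightarrow> real ^ 'd \<Rightarrow> nat"
  where "tuple_rank D u t = 1 + card {t' \<in> D. utility u t' > utility u t}"

definition rank_regret :: "(real ^ 'd) set \<Rightarrow> real ^ 'd \<Rightarrow> (real ^ 'd) set \<Rightarrow> nat"
  where "rank_regret D u S = Min (tuple_rank D u ` S)"

(* Although U may be infinite, all ranks lie in {1..card D} when D is finite and
   S is a nonempty subset of D, so the maximum is taken over a finite set of values. *)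
definition max_rank_regret :: "(real ^ 'd) set \<Rightarrow> (real ^ 'd) set \<Rightarrow> (real ^ 'd) set \<Rightarrow> nat"
  where "max_rank_regret D U S = Max ((\<lambda>u. rank_regret D u S) ` U)"

definition RRRM_optimal ::
    "(real ^ 'd) set \<Rightarrow> (real ^ 'd) set \<Rightarrow> nat \<Rightarrow> (real ^ 'd) set \<Rightarrow> bool"
  where "RRRM_optimal D U r S \<longleftrightarrow>
    is_arg_min (max_rank_regret D U) (\<lambda>S. S \<noteq> {} \<and> S \<subseteq> D \<and> card S \<le> r) S"

definition RRM_optimal :: "(real ^ 'd) set \<Rightarrow> nat \<Rightarrow> (real ^ 'd) set \<Rightarrow> bool"
  where "RRM_optimal D r S \<longleftrightarrow> RRRM_optimal D linear_utilities r S"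

end

theory Submission
  imports Defs
begin

text \<open>
  Translating by \<open>v\<close> adds the constant \<open>utility u v\<close> to the utility of every tuple, so no comparison of
  utilities for the same \<open>u\<close> changes, and neither does any rank or rank-regret. Hence translation is a
  bijection between the feasible sets of the two problems that preserves the objective.
\<close>

lemma utility_add: "utility u (v + x) = utility u v + utility u x"
  by (simp add: utility_def distrib_left sum.distrib)

lemma tuple_rank_translation: "tuple_rank ((+) v ` D) u (v + x) = tuple_rank D u x"
proof -
  have "{y \<in> (+) v ` D. utility u y > utility u (v + x)} =
        (+) v ` {y \<in> D. utility u y > utility u x}"
    by (auto simp: utility_add)
  \<comment> \<open>Translation is injective, so the translated set of better tuples has the same
    cardinality.\<close>
  then show ?thesis
    by (simp add: tuple_rank_def card_image)
qed

lemma rank_regret_translation: "rank_regret ((+) v ` D) u ((+) v ` S) = rank_regret D u S"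
  by (simp add: rank_regret_def image_image tuple_rank_translation)

text \<open>The rank-regrets agree for each single \<open>u\<close>, so both sides apply
  \<open>Max\<close> to the same set.\<close>

lemma max_rank_regret_translation:
  "max_rank_regret ((+) v ` D) U ((+) v ` S) = max_rank_regret D U S"
  by (simp add: max_rank_regret_def rank_regret_translation)

lemma RRRM_optimal_translation:
  "RRRM_optimal ((+) v ` D) U r ((+) v ` S) \<longleftrightarrow> RRRM_optimal D U r S"
proof -
  \<comment> \<open>Every competitor in the translated dataset is the translate of one in
    \<open>D\<close>; keeping \<open>P\<close> arbitrary lets the whole feasibility and comparison
    condition be transported at once.\<close>
  have ex: "(\<exists>T. T \<subseteq> (+) v ` D \<and> P T) \<longleftrightarrow> (\<exists>T. T \<subseteq> D \<and> P ((+) v ` T))" for P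
    by (auto simp: subset_image_iff)
  \<comment> \<open>This is the existence of a strictly better feasible set, which
    \<open>is_arg_min\<close> denies.\<close>
  have "(\<exists>T. T \<subseteq> (+) v ` D \<and> T \<noteq> {} \<and> card T \<le> r \<and>
            max_rank_regret ((+) v ` D) U T < max_rank_regret D U S) \<longleftrightarrow>
        (\<exists>T. T \<subseteq> D \<and> T \<noteq> {} \<and> card T \<le> r \<and> max_rank_regret D U T < max_rank_regret D U S)"
    by (subst ex) (simp add: max_rank_regret_translation card_image)
  moreover have "(+) v ` S \<subseteq> (+) v ` D \<longleftrightarrow> S \<subseteq> D"
    by (simp add: inj_image_subset_iff)
  ultimately show ?thesis
    by (auto simp: RRRM_optimal_def is_arg_min_def max_rank_regret_translation card_image)
qed

theorem theorem1:
  fixes n :: nat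
    and t t' :: "nat \<Rightarrow> real ^ 'd"
    and lam :: "'d \<Rightarrow> real"
  assumes "n \<ge> 1"
    and "inj_on t {1..n}"
    and "\<And>j. lam j \<ge> 0"
    and "\<And>i j. i \<in> {1..n} \<Longrightarrow> t' i $ j = lam j + t i $ j"
  shows "(\<forall>r U I. 1 \<le> r \<longrightarrow> U \<noteq> {} \<longrightarrow> U \<subseteq> linear_utilities \<longrightarrow>
            I \<noteq> {} \<longrightarrow> I \<subseteq> {1..n} \<longrightarrow> card I \<le> r \<longrightarrow>
            (RRRM_optimal (t ` {1..n}) U r (t ` I) \<longleftrightarrow> RRRM_optimal (t' ` {1..n}) U r (t' ` I)))
       \<and> (\<forall>r I. 1 \<le> r \<longrightarrow> I \<noteq> {} \<longrightarrow> I \<subseteq> {1..n} \<longrightarrow> card I \<le> r \<longrightarrow>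
            (RRM_optimal (t ` {1..n}) r (t ` I) \<longleftrightarrow> RRM_optimal (t' ` {1..n}) r (t' ` I)))"
proof -
  define v where "v = (\<chi> j. lam j)"
  have "t' i = v + t i" if "i \<in> {1..n}" for i
    using assms(4)[OF that] by (simp add: v_def vec_eq_iff)
  \<comment> \<open>Used both for \<open>{1..n}\<close>, giving the dataset, and for
    \<open>I\<close>, giving the candidate solution.\<close>
  then have t': "t' ` I = (+) v ` t ` I" if "I \<subseteq> {1..n}" for I
    using that by (force simp: image_image intro!: image_cong)
  show ?thesis
    by (simp add: t' RRM_optimal_def RRRM_optimal_translation)
qed

end
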